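(* The inclusion functor $\iota: \mathcal{C}^{\infty}\mathbf{Rng} \hookrightarrow \mathcal{C}^{\infty}\mathbf{Str}$ has a left adjoint $L: \mathcal{C}^{\infty}\mathbf{Str} \to \mathcal{C}^{\infty}\mathbf{Rng}$ given by $M \mapsto M/\theta_M$, where $\theta_M$ is the least $\mathcal{C}^{\infty}$-congruence of $M$ such that $M/\theta_M$ is a $\mathcal{C}^{\infty}$-ring. Moreover, the unit of the adjunction $L \dashv \iota$ has components $(q_M)_{M \in \mathrm{Obj}(\mathcal{C}^{\infty}\mathbf{Str})}$, where $q_M : M \twoheadrightarrow M/\theta_M$ is the quotient homomorphism.
   Context: $\mathbb{N}=\{0,1,2,\dots\}$. A $\mathcal{C}^{\infty}$-structure is a pair $(A,\Phi)$, where $A$ is a set and $\Phi$ assigns to each $n\in\mathbb{N}$ and each smooth function $f\in\mathcal{C}^{\infty}(\mathbb{R}^n,\mathbb{R})$ a function $\Phi(f):A^n\to A$. A morphism of $\mathcal{C}^{\infty}$-structures $\varphi:(A,\Phi)\to(B,\Psi)$ is a function $\varphi:A\to B$ with $\varphi(\Phi(f)(a_1,\dots,a_n))=\Psi(f)(\varphi(a_1),\dots,\varphi(a_n))$ for all $n$, all $f\in\mathcal{C}^{\infty}(\mathbb{R}^n,\mathbb{R})$ and all $a_i\in A$. $\mathcal{C}^{\infty}\mathbf{Str}$ is the category of $\mathcal{C}^{\infty}$-structures and their morphisms. A $\mathcal{C}^{\infty}$-structure $(A,\Phi)$ is a $\mathcal{C}^{\infty}$-ring if (1) for each $n$ and $k\le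 n$, the projection $p_k:\mathbb{R}^n\to\mathbb{R}$ onto the $k$-th coordinate is sent to the projection $\pi_k:A^n\to A$ onto the $k$-th coordinate; and (2) whenever $f\in\mathcal{C}^{\infty}(\mathbb{R}^n,\mathbb{R})$, $g_1,\dots,g_n,h\in\mathcal{C}^{\infty}(\mathbb{R}^k,\mathbb{R})$ and $h=f\circ(g_1,\dots,g_n)$, then $\Phi(h)=\Phi(f)\circ(\Phi(g_1),\dots,\Phi(g_n))$. $\mathcal{C}^{\infty}\mathbf{Rng}$ is the full subcategory of $\mathcal{C}^{\infty}\mathbf{Str}$ whose objects are the $\mathcal{C}^{\infty}$-rings. A $\mathcal{C}^{\infty}$-congruence of a $\mathcal{C}^{\infty}$-structure $M=(A,\Phi)$ is an equivalence relation $\theta\subseteq A\times A$ such that for all $n$, $f\in\mathcal{C}^{\infty}(\mathbb{R}^n,\mathbb{R})$ and $(x_1,y_1),\dots,(x_n,y_n)\in\theta$ one has $(\Phi(f)(x_1,\dots,x_n),\Phi(f)(y_1,\dots,y_n))\in\theta$. The quotient $M/\theta$ carries the structure $\overline{\Phi}(f)(\overline{a_1},\dots,\overline{a_n})=\overline{\Phi(f)(a_1,\dots,a_n)}$. "Least" is with respect to inclusion. *)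

theory Defs
  imports "HOL-Analysis.Analysis"
begin

section \<open>Smooth functions on Euclidean spaces of varying dimension\<close>

text \<open>
  \<^term>\<open>Euclidean_space n\<close> realises the space of real n-tuples as the functions
  \<^typ>\<open>nat \<Rightarrow> real\<close> that vanish from index \<^term>\<open>n\<close> on; coordinates are numbered
  \<open>0, \<dots>, n - 1\<close>.
\<close>

definition partial_deriv :: "nat \<Rightarrow> ((nat \<Rightarrow> real) \<Rightarrow> real) \<Rightarrow> (nat \<Rightarrow> real) \<Rightarrow> real" where
  "partial_deriv i f x = deriv (\<lambda>t. f (x(i := t))) (x i)"

primrec C_fun :: "nat \<Rightarrow> nat \<Rightarrow> ((nat \<Rightarrow> real) \<Rightarrow> real) \<Rightarrow> bool" where
  "C_fun n 0 f \<longleftrightarrow> continuous_map (Euclidean_space n) euclideanreal f"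
| "C_fun n (Suc k) f \<longleftrightarrow> continuous_map (Euclidean_space n) euclideanreal f \<and>
     (\<forall>i<n. (\<forall>x\<in>topspace (Euclidean_space n).
               (\<lambda>t. f (x(i := t))) field_differentiable at (x i))
            \<and> C_fun n k (partial_deriv i f))"

text \<open>
  The functions are extensional, so that equality in \<^typ>\<open>(nat \<Rightarrow> real) \<Rightarrow> real\<close> is
  equality of functions on the n-dimensional space.
\<close>

definition smooth_funs :: "nat \<Rightarrow> ((nat \<Rightarrow> real) \<Rightarrow> real) set" where
  "smooth_funs n = {f \<in> extensional (topspace (Euclidean_space n)). \<forall>k. C_fun n k f}"

definition coord :: "nat \<Rightarrow> nat \<Rightarrow> (nat \<Rightarrow> real) \<Rightarrow> real" where
  "coord n k = (\<lambda>x\<in>topspace (Euclidean_space n). x k)"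

definition map_tuple ::
    "nat \<Rightarrow> (nat \<Rightarrow> (nat \<Rightarrow> real) \<Rightarrow> real) \<Rightarrow> (nat \<Rightarrow> real) \<Rightarrow> nat \<Rightarrow> real" where
  "map_tuple n g x = (\<lambda>i. if i < n then g i x else 0)"


section \<open>Smooth structures and smooth rings\<close>

definition tuples :: "'a set \<Rightarrow> nat \<Rightarrow> 'a list set" where
  "tuples A n = {as \<in> lists A. length as = n}"

record 'a cinf =
  car :: "'a set"
  ops :: "nat \<Rightarrow> ((nat \<Rightarrow> real) \<Rightarrow> real) \<Rightarrow> 'a list \<Rightarrow> 'a"

text \<open>
  The arity is a separate argument of \<^const>\<open>ops\<close>: functions of different arities may
  coincide as elements of \<^typ>\<open>(nat \<Rightarrow> real) \<Rightarrow> real\<close>.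
\<close>

definition cinf_structure :: "'a cinf \<Rightarrow> bool" where
  "cinf_structure M \<longleftrightarrow>
     (\<forall>n. ops M n \<in> smooth_funs n \<rightarrow>\<^sub>E (tuples (car M) n \<rightarrow>\<^sub>E car M))"

definition cinf_ring :: "'a cinf \<Rightarrow> bool" where
  "cinf_ring M \<longleftrightarrow> cinf_structure M \<and>
     (\<forall>n. \<forall>k<n. \<forall>as\<in>tuples (car M) n. ops M n (coord n k) as = as ! k) \<and>
     (\<forall>n k. \<forall>f\<in>smooth_funs n. \<forall>g h.
        (\<forall>i<n. g i \<in> smooth_funs k) \<longrightarrow> h \<in> smooth_funs k \<longrightarrow>
        (\<forall>x\<in>topspace (Euclidean_space k). h x = f (map_tuple n g x)) \<longrightarrow>
        (\<forall>as\<in>tuples (car M) k.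
           ops M k h as = ops M n f (map (\<lambda>i. ops M k (g i) as) [0..<n])))"

definition cinf_hom :: "'a cinf \<Rightarrow> 'b cinf \<Rightarrow> ('a \<Rightarrow> 'b) set" where
  "cinf_hom M N = {\<phi> \<in> car M \<rightarrow>\<^sub>E car N.
     \<forall>n. \<forall>f\<in>smooth_funs n. \<forall>as\<in>tuples (car M) n.
       \<phi> (ops M n f as) = ops N n f (map \<phi> as)}"


section \<open>Congruences and quotients\<close>

definition cinf_congruence :: "'a cinf \<Rightarrow> ('a \<times> 'a) set \<Rightarrow> bool" where
  "cinf_congruence M \<theta> \<longleftrightarrow> equiv (car M) \<theta> \<and>
     (\<forall>n. \<forall>f\<in>smooth_funs n. \<forall>xs ys.
        length xs = n \<longrightarrow> list_all2 (\<lambda>x y. (x, y) \<in> \<theta>) xs ys \<longrightarrow>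
        (ops M n f xs, ops M n f ys) \<in> \<theta>)"

text \<open>
  The union ranges over all tuples of representatives; for a congruence all its members
  are the same class (lemma \<open>ops_cinf_quotient\<close>).
\<close>

definition cinf_quotient :: "'a cinf \<Rightarrow> ('a \<times> 'a) set \<Rightarrow> 'a set cinf" where
  "cinf_quotient M \<theta> =
     \<lparr>car = car M // \<theta>,
      ops = (\<lambda>n. \<lambda>f\<in>smooth_funs n. \<lambda>Xs\<in>tuples (car M // \<theta>) n.
               \<Union>as\<in>{as. list_all2 (\<in>) as Xs}. \<theta> `` {ops M n f as})\<rparr>"

definition quotient_hom :: "'a cinf \<Rightarrow> ('a \<times> 'a) set \<Rightarrow> 'a \<Rightarrow> 'a set" where
  "quotient_hom M \<theta> = (\<lambda>a\<in>car M. \<theta> `` {a})"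

lemma ops_cinf_quotient:
  assumes M: "cinf_structure M" and \<theta>: "cinf_congruence M \<theta>"
    and f: "f \<in> smooth_funs n" and as: "as \<in> tuples (car M) n"
  shows "ops (cinf_quotient M \<theta>) n f (map (\<lambda>a. \<theta> `` {a}) as) = \<theta> `` {ops M n f as}"
proof -
  have eq: "equiv (car M) \<theta>"
    using \<theta> by (simp add: cinf_congruence_def)
  let ?Xs = "map (\<lambda>a. \<theta> `` {a}) as"
  have Xs: "?Xs \<in> tuples (car M // \<theta>) n"
    using as by (auto simp: tuples_def in_lists_conv_set intro: quotientI)
  have refl: "list_all2 (\<in>) as ?Xs"
    using as equiv_class_self[OF eq]
    by (auto simp: tuples_def list_all2_conv_all_nth in_lists_conv_set)
  have "\<theta> `` {ops M n f bs} = \<theta> `` {ops M n f as}" if bs: "list_all2 (\<in>) bs ?Xs" for bs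
  proof -
    have "list_all2 (\<lambda>x y. (x, y) \<in> \<theta>) as bs"
      using bs by (auto simp: list_all2_conv_all_nth)
    moreover have "length as = n"
      using as by (simp add: tuples_def)
    ultimately have "(ops M n f as, ops M n f bs) \<in> \<theta>"
      using \<theta> f unfolding cinf_congruence_def by blast
    then show ?thesis
      using eq by (metis equiv_class_eq)
  qed
  then have "(\<Union>bs\<in>{bs. list_all2 (\<in>) bs ?Xs}. \<theta> `` {ops M n f bs}) = \<theta> `` {ops M n f as}"
    using refl by blast
  then show ?thesis
    using f Xs by (simp add: cinf_quotient_def)
qed

definition rng_congruence :: "'a cinf \<Rightarrow> ('a \<times> 'a) set \<Rightarrow> bool" where
  "rng_congruence M \<theta> \<longleftrightarrow> cinf_congruence M \<theta> \<and> cinf_ring (cinf_quotient M \<theta>)"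

definition theta :: "'a cinf \<Rightarrow> ('a \<times> 'a) set" where
  "theta M = (LEAST \<theta>. rng_congruence M \<theta>)"


section \<open>Categories and adjunctions\<close>

text \<open>Composition \<^term>\<open>cmp C X Y Z g f\<close> is \<open>g\<close> after \<open>f\<close>, for \<open>f\<close> from \<open>X\<close> to \<open>Y\<close> and \<open>g\<close> from \<open>Y\<close> to \<open>Z\<close>.\<close>

record ('o, 'm) cat =
  obj :: "'o set"
  hom :: "'o \<Rightarrow> 'o \<Rightarrow> 'm set"
  idn :: "'o \<Rightarrow> 'm"
  cmp :: "'o \<Rightarrow> 'o \<Rightarrow> 'o \<Rightarrow> 'm \<Rightarrow> 'm \<Rightarrow> 'm"

definition is_category :: "('o, 'm) cat \<Rightarrow> bool" where
  "is_category C \<longleftrightarrow>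
     (\<forall>X\<in>obj C. idn C X \<in> hom C X X) \<and>
     (\<forall>X\<in>obj C. \<forall>Y\<in>obj C. \<forall>Z\<in>obj C. \<forall>f\<in>hom C X Y. \<forall>g\<in>hom C Y Z.
        cmp C X Y Z g f \<in> hom C X Z) \<and>
     (\<forall>X\<in>obj C. \<forall>Y\<in>obj C. \<forall>f\<in>hom C X Y.
        cmp C X Y Y (idn C Y) f = f \<and> cmp C X X Y f (idn C X) = f) \<and>
     (\<forall>W\<in>obj C. \<forall>X\<in>obj C. \<forall>Y\<in>obj C. \<forall>Z\<in>obj C.
        \<forall>f\<in>hom C W X. \<forall>g\<in>hom C X Y. \<forall>h\<in>hom C Y Z.
        cmp C W Y Z h (cmp C W X Y g f) = cmp C W X Z (cmp C X Y Z h g) f)"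

record ('o, 'm, 'p, 'n) func =
  fob :: "'o \<Rightarrow> 'p"
  far :: "'o \<Rightarrow> 'o \<Rightarrow> 'm \<Rightarrow> 'n"

definition is_functor ::
    "('o, 'm) cat \<Rightarrow> ('p, 'n) cat \<Rightarrow> ('o, 'm, 'p, 'n) func \<Rightarrow> bool" where
  "is_functor C D F \<longleftrightarrow>
     (\<forall>X\<in>obj C. fob F X \<in> obj D) \<and>
     (\<forall>X\<in>obj C. \<forall>Y\<in>obj C. \<forall>f\<in>hom C X Y. far F X Y f \<in> hom D (fob F X) (fob F Y)) \<and>
     (\<forall>X\<in>obj C. far F X X (idn C X) = idn D (fob F X)) \<and>
     (\<forall>X\<in>obj C. \<forall>Y\<in>obj C. \<forall>Z\<in>obj C. \<forall>f\<in>hom C X Y. \<forall>g\<in>hom C Y Z.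
        far F X Z (cmp C X Y Z g f)
          = cmp D (fob F X) (fob F Y) (fob F Z) (far F Y Z g) (far F X Y f))"

text \<open>
  \<open>L\<close> is left adjoint to \<open>R\<close>: \<open>\<Phi> X Y\<close> is a bijection from the arrows \<open>L X \<rightarrow> Y\<close> in \<open>D\<close> to the
  arrows \<open>X \<rightarrow> R Y\<close> in \<open>C\<close>, natural in both variables.
\<close>

definition adjunction ::
    "('o, 'm) cat \<Rightarrow> ('p, 'n) cat \<Rightarrow> ('o, 'm, 'p, 'n) func \<Rightarrow> ('p, 'n, 'o, 'm) func
      \<Rightarrow> ('o \<Rightarrow> 'p \<Rightarrow> 'n \<Rightarrow> 'm) \<Rightarrow> bool" where
  "adjunction C D L R \<Phi> \<longleftrightarrow>
     is_category C \<and> is_category D \<and> is_functor C D L \<and> is_functor D C R \<and>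
     (\<forall>X\<in>obj C. \<forall>Y\<in>obj D. bij_betw (\<Phi> X Y) (hom D (fob L X) Y) (hom C X (fob R Y))) \<and>
     (\<forall>X\<in>obj C. \<forall>X'\<in>obj C. \<forall>Y\<in>obj D. \<forall>u\<in>hom C X' X. \<forall>\<psi>\<in>hom D (fob L X) Y.
        \<Phi> X' Y (cmp D (fob L X') (fob L X) Y \<psi> (far L X' X u))
          = cmp C X' X (fob R Y) (\<Phi> X Y \<psi>) u) \<and>
     (\<forall>X\<in>obj C. \<forall>Y\<in>obj D. \<forall>Y'\<in>obj D. \<forall>v\<in>hom D Y Y'. \<forall>\<psi>\<in>hom D (fob L X) Y.
        \<Phi> X Y' (cmp D (fob L X) Y Y' v \<psi>)
          = cmp C X (fob R Y) (fob R Y') (far R Y Y' v) (\<Phi> X Y \<psi>))"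

definition adj_unit ::
    "('p, 'n) cat \<Rightarrow> ('o, 'm, 'p, 'n) func \<Rightarrow> ('o \<Rightarrow> 'p \<Rightarrow> 'n \<Rightarrow> 'm) \<Rightarrow> 'o \<Rightarrow> 'm" where
  "adj_unit D L \<Phi> X = \<Phi> X (fob L X) (idn D (fob L X))"

definition full_subcat :: "('o, 'm) cat \<Rightarrow> ('o \<Rightarrow> bool) \<Rightarrow> ('o, 'm) cat" where
  "full_subcat C P = C\<lparr>obj := {X \<in> obj C. P X}\<rparr>"

definition inclusion :: "('o, 'm, 'o, 'm) func" where
  "inclusion = \<lparr>fob = (\<lambda>X. X), far = (\<lambda>X Y f. f)\<rparr>"


section \<open>The categories of smooth structures and of smooth rings\<close>

text \<open>
  The objects of one category must have carriers in one type \<open>'u\<close>, whereas the quotient of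
  a structure on \<open>'u\<close> has its carrier in \<open>'u set\<close>. As in set theory, where a set of elements
  of a universe is itself an element, we fix a collection \<open>U\<close> of admissible carriers and a
  map \<open>c\<close> that views the equivalence classes on a carrier as elements of \<open>'u\<close>; \<open>U\<close> must
  be closed under quotients formed in this way.
\<close>

definition quotient_universe :: "'u set set \<Rightarrow> ('u set \<Rightarrow> 'u) \<Rightarrow> bool" where
  "quotient_universe U c \<longleftrightarrow>
     (\<forall>A\<in>U. \<forall>\<theta>. equiv A \<theta> \<longrightarrow> inj_on c (A // \<theta>) \<and> c ` (A // \<theta>) \<in> U)"

text \<open>
  Every type is such a universe with all its subsets admissible, \<open>c\<close> picking representatives.
\<close>

lemma quotient_universe_UNIV: "quotient_universe UNIV (\<lambda>X :: 'u set. SOME x. x \<in> X)"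
proof -
  have "inj_on (\<lambda>X. SOME x. x \<in> X) (A // \<theta>)" if eq: "equiv A \<theta>" for A :: "'u set" and \<theta>
  proof (rule inj_onI)
    fix X Y assume X: "X \<in> A // \<theta>" and Y: "Y \<in> A // \<theta>"
      and XY: "(SOME x. x \<in> X) = (SOME x. x \<in> Y)"
    have "(SOME x. x \<in> X) \<in> X" "(SOME x. x \<in> Y) \<in> Y"
      using in_quotient_imp_non_empty[OF eq X] in_quotient_imp_non_empty[OF eq Y]
      by (simp_all add: some_in_eq)
    then show "X = Y"
      using XY quotient_disj[OF eq X Y] by auto
  qed
  then show ?thesis
    by (simp add: quotient_universe_def)
qed

text \<open>
  There are also arbitrarily large universes in which \<open>c\<close> codes all admissible sets, hence all
  their nonempty subsets, injectively: take the nonempty sets of cardinality at most that of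
  an infinite type \<open>'k\<close>, with elements in \<^typ>\<open>'k set\<close>.
\<close>

lemma quotient_universe_coded_sets:
  assumes inf: "infinite (UNIV :: 'k set)"
  defines "U \<equiv> {A :: 'k set set. \<exists>f :: 'k \<Rightarrow> 'k set. A = range f}"
  shows "\<exists>c. inj_on c U \<and> quotient_universe U c"
proof -
  obtain p :: "'k \<times> 'k \<Rightarrow> 'k" where p: "inj p"
    using card_of_Times_same_infinite[OF inf]
      card_of_ordIso[of "UNIV \<times> UNIV :: ('k \<times> 'k) set" "UNIV :: 'k set"]
    by (auto simp: bij_betw_def)
  define e where "e A = (SOME f :: 'k \<Rightarrow> 'k set. A = range f)" for A
  have e: "A = range (e A)" if "A \<in> U" for A
    using that someI_ex[of "\<lambda>f :: 'k \<Rightarrow> 'k set. A = range f"] by (simp add: U_def e_def)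
  define c where "c A = p ` {(i, y). y \<in> e A i}" for A
  have c_inj: "inj_on c U"
  proof (rule inj_onI)
    fix A B assume A: "A \<in> U" and B: "B \<in> U" and "c A = c B"
    then have "{(i, y). y \<in> e A i} = {(i, y). y \<in> e B i}"
      using p by (simp add: c_def inj_image_eq_iff)
    then have "e A = e B"
      by blast
    then show "A = B"
      using e[OF A] e[OF B] by simp
  qed
  have "inj_on c (A // \<theta>) \<and> c ` (A // \<theta>) \<in> U" if A: "A \<in> U" and eq: "equiv A \<theta>" for A \<theta>
  proof
    obtain f :: "'k \<Rightarrow> 'k set" where f: "A = range f"
      using A by (auto simp: U_def)
    have "X \<in> U" if X: "X \<in> A // \<theta>" for X
    proof -
      obtain x where x: "x \<in> X"
        using in_quotient_imp_non_empty[OF eq X] by blast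
      have "X = range (\<lambda>i. if f i \<in> X then f i else x)"
        using x in_quotient_imp_subset[OF eq X] f by (auto simp: image_iff)
      then show ?thesis
        unfolding U_def by blast
    qed
    then show "inj_on c (A // \<theta>)"
      using c_inj by (meson inj_on_subset subsetI)
    have "c ` (A // \<theta>) = range (\<lambda>i. c (\<theta> `` {f i}))"
      unfolding f by (auto simp: quotient_def)
    then show "c ` (A // \<theta>) \<in> U"
      unfolding U_def by blast
  qed
  then show ?thesis
    using c_inj by (auto simp: quotient_universe_def)
qed

definition CinfStr :: "'u set set \<Rightarrow> ('u cinf, 'u \<Rightarrow> 'u) cat" where
  "CinfStr U =
     \<lparr>obj = {M. cinf_structure M \<and> car M \<in> U},
      hom = cinf_hom,
      idn = (\<lambda>M. \<lambda>a\<in>car M. a),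
      cmp = (\<lambda>M N P g f. compose (car M) g f)\<rparr>"

definition CinfRng :: "'u set set \<Rightarrow> ('u cinf, 'u \<Rightarrow> 'u) cat" where
  "CinfRng U = full_subcat (CinfStr U) cinf_ring"

text \<open>For \<open>c\<close> injective on the carrier, \<open>c\<close> is an isomorphism onto the transported structure.\<close>

definition transport :: "('a \<Rightarrow> 'b) \<Rightarrow> 'a cinf \<Rightarrow> 'b cinf" where
  "transport c N =
     \<lparr>car = c ` car N,
      ops = (\<lambda>n. \<lambda>f\<in>smooth_funs n. \<lambda>bs\<in>tuples (c ` car N) n.
               c (ops N n f (map (inv_into (car N) c) bs)))\<rparr>"

end

theory Submission
  imports Defs
begin

text \<open>
  For a surjective homomorphism \<open>q\<close> from \<open>M\<close> onto \<open>N\<close>, the structure \<open>N\<close> is a smooth ring iff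
  the kernel of \<open>q\<close> contains the pairs of elements of \<open>M\<close> that the ring laws require to be equal.
  So the congruences with ring quotient are the congruences containing a fixed relation; they are
  closed under intersection, and \<open>theta M\<close> is the intersection of all of them. The kernel of a
  homomorphism from \<open>M\<close> to a smooth ring is one of them, so the homomorphism factors uniquely
  through \<open>M/theta M\<close>; such universal arrows make up a left adjoint of the inclusion.
\<close>

section \<open>Smoothness of the coordinate functions\<close>

lemma fun_upd_in_Euclidean_space:
  assumes "x \<in> topspace (Euclidean_space n)" "i < n"
  shows "x(i := t) \<in> topspace (Euclidean_space n)"
  using assms by (auto simp: topspace_Euclidean_space)

text \<open>Needed because \<open>coord\<close> is a restriction and agrees with the plain
  projection only on the space. Partial derivatives with \<open>i < n\<close> see a function only
  along lines that stay in the space, so agreement passes to them; \<open>f\<close> and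
  \<open>g\<close> are generalised for this.\<close>

lemma C_fun_cong:
  assumes "\<And>x. x \<in> topspace (Euclidean_space n) \<Longrightarrow> f x = g x"
  shows "C_fun n k f \<longleftrightarrow> C_fun n k g"
  using assms
proof (induction k arbitrary: f g)
  case 0
  then show ?case
    by (auto intro: continuous_map_eq)
next
  case (Suc k)
  have cont: "continuous_map (Euclidean_space n) euclideanreal f
      \<longleftrightarrow> continuous_map (Euclidean_space n) euclideanreal g"
    using Suc.prems by (auto intro: continuous_map_eq)
  have upd: "(\<lambda>t. f (x(i := t))) = (\<lambda>t. g (x(i := t)))"
    if "x \<in> topspace (Euclidean_space n)" "i < n" for x i
    using Suc.prems fun_upd_in_Euclidean_space[OF that] by blast
  have "C_fun n k (partial_deriv i f) \<longleftrightarrow> C_fun n k (partial_deriv i g)" if "i < n" for i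
    by (rule Suc.IH) (simp add: partial_deriv_def upd that)
  then show ?case
    by (simp add: cont upd cong: conj_cong)
qed

lemma C_fun_const: "C_fun n k (\<lambda>_. a)"
proof (induction k arbitrary: a)
  case (Suc k)
  have "partial_deriv i (\<lambda>_. a) = (\<lambda>_. 0)" for i
    by (simp add: partial_deriv_def fun_eq_iff)
  then show ?case
    using Suc by simp
qed simp

text \<open>The partial derivatives are the constants 0 and 1, so a single unfolding reduces every
  order to \<open>C_fun_const\<close>.\<close>

lemma C_fun_coord: "C_fun n m (\<lambda>x. x k)"
proof -
  have cont: "continuous_map (Euclidean_space n) euclideanreal (\<lambda>x. x k)"
    unfolding Euclidean_space_def
    by (intro continuous_map_from_subtopology continuous_map_product_projection) simp
  have "partial_deriv i (\<lambda>x. x k) = (\<lambda>_. if i = k then 1 else 0)" for i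
    by (auto simp: partial_deriv_def fun_eq_iff)
  moreover have "(\<lambda>t. (x(i := t)) k) field_differentiable at (x i)" for x :: "nat \<Rightarrow> real" and i
    by (cases "i = k") auto
  ultimately show ?thesis
    by (cases m) (simp_all add: cont C_fun_const del: fun_upd_apply)
qed

text \<open>Closure and the homomorphism equation are available only at smooth functions; this makes
  them applicable in the projection law.\<close>

lemma coord_smooth: "coord n k \<in> smooth_funs n"
proof -
  have "C_fun n m (coord n k)" for m
    using C_fun_coord[of n m k] C_fun_cong[of n "coord n k" "\<lambda>x. x k" m]
    by (simp add: coord_def)
  then show ?thesis
    by (simp add: smooth_funs_def coord_def)
qed


section \<open>Kernels and ring laws\<close>

lemma tuples_nth: "as \<in> tuples A n \<Longrightarrow> k < n \<Longrightarrow> as ! k \<in> A"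
  by (auto simp: tuples_def in_lists_conv_set)

lemma map_in_tuples: "as \<in> tuples A n \<Longrightarrow> (\<And>a. a \<in> A \<Longrightarrow> f a \<in> B) \<Longrightarrow> map f as \<in> tuples B n"
  by (auto simp: tuples_def in_lists_conv_set)

lemma map_upt_in_tuples: "(\<And>i. i < n \<Longrightarrow> f i \<in> A) \<Longrightarrow> map f [0..<n] \<in> tuples A n"
  by (auto simp: tuples_def in_lists_conv_set)

text \<open>Entrywise choice of preimages: along a surjective homomorphism, laws on the target can
  be checked at images of source tuples.\<close>

lemma tuples_image:
  assumes "bs \<in> tuples (f ` A) n"
  obtains as where "as \<in> tuples A n" "bs = map f as"
proof -
  have "bs \<in> map f ` lists A" and "length bs = n"
    using assms by (simp_all add: tuples_def lists_image)
  then obtain as where "as \<in> lists A" "bs = map f as" "length as = n"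
    by (metis imageE length_map)
  then show thesis
    by (intro that) (simp_all add: tuples_def)
qed

lemma ops_closed:
  "cinf_structure M \<Longrightarrow> f \<in> smooth_funs n \<Longrightarrow> as \<in> tuples (car M) n \<Longrightarrow> ops M n f as \<in> car M"
  unfolding cinf_structure_def by blast

lemma cinf_hom_closed: "\<phi> \<in> cinf_hom M N \<Longrightarrow> a \<in> car M \<Longrightarrow> \<phi> a \<in> car N"
  by (auto simp: cinf_hom_def)

lemma cinf_hom_ops:
  "\<phi> \<in> cinf_hom M N \<Longrightarrow> f \<in> smooth_funs n \<Longrightarrow> as \<in> tuples (car M) n
    \<Longrightarrow> \<phi> (ops M n f as) = ops N n f (map \<phi> as)"
  by (simp add: cinf_hom_def)

lemma cinf_hom_extensional: "\<phi> \<in> cinf_hom M N \<Longrightarrow> \<phi> \<in> extensional (car M)"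
  by (auto simp: cinf_hom_def PiE_def)

lemma cinf_hom_compose:
  assumes M: "cinf_structure M" and f: "f \<in> cinf_hom M N" and g: "g \<in> cinf_hom N P"
  shows "compose (car M) g f \<in> cinf_hom M P"
proof -
  have "compose (car M) g f (ops M n h as) = ops P n h (map (compose (car M) g f) as)"
    if h: "h \<in> smooth_funs n" and as: "as \<in> tuples (car M) n" for n h as
  proof -
    have "map (compose (car M) g f) as = map g (map f as)"
      using as by (auto simp: tuples_def in_lists_conv_set compose_def)
    moreover have "map f as \<in> tuples (car N) n"
      using as cinf_hom_closed[OF f] by (rule map_in_tuples)
    moreover have "compose (car M) g f (ops M n h as) = g (ops N n h (map f as))"
      using ops_closed[OF M h as] cinf_hom_ops[OF f h as] by (simp add: compose_def)
    ultimately show ?thesis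
      using cinf_hom_ops[OF g h] by presburger
  qed
  moreover have "compose (car M) g f \<in> car M \<rightarrow>\<^sub>E car P"
    using cinf_hom_closed[OF f] cinf_hom_closed[OF g] by (auto simp: compose_def)
  ultimately show ?thesis
    by (simp add: cinf_hom_def)
qed

text \<open>Confined to the carrier, so that it is an equivalence relation on \<open>car M\<close>,
  whatever \<open>q\<close> does elsewhere.\<close>

definition hom_kernel :: "'a cinf \<Rightarrow> ('a \<Rightarrow> 'b) \<Rightarrow> ('a \<times> 'a) set" where
  "hom_kernel M q = {(x, y). x \<in> car M \<and> y \<in> car M \<and> q x = q y}"

text \<open>The two axioms of \<open>cinf_ring\<close> with equality replaced by membership in
  \<open>R\<close>. For \<open>R\<close> the kernel of a homomorphism \<open>q\<close>, they are the
  ring laws after applying \<open>q\<close>.\<close>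

definition ring_laws :: "'a cinf \<Rightarrow> ('a \<times> 'a) set \<Rightarrow> bool" where
  "ring_laws M R \<longleftrightarrow>
     (\<forall>n. \<forall>k<n. \<forall>as\<in>tuples (car M) n. (ops M n (coord n k) as, as ! k) \<in> R) \<and>
     (\<forall>n k. \<forall>f\<in>smooth_funs n. \<forall>g h.
        (\<forall>i<n. g i \<in> smooth_funs k) \<longrightarrow> h \<in> smooth_funs k \<longrightarrow>
        (\<forall>x\<in>topspace (Euclidean_space k). h x = f (map_tuple n g x)) \<longrightarrow>
        (\<forall>as\<in>tuples (car M) k.
           (ops M k h as, ops M n f (map (\<lambda>i. ops M k (g i) as) [0..<n])) \<in> R))"

text \<open>\<open>R\<close> occurs in \<open>ring_laws\<close> only as a membership in conclusions,
  so the laws survive intersection. A least congruence exists for this reason.\<close>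

lemma ring_laws_Inter: "\<lbrakk>\<And>R. R \<in> \<R> \<Longrightarrow> ring_laws M R\<rbrakk> \<Longrightarrow> ring_laws M (\<Inter>\<R>)"
  unfolding ring_laws_def Inter_iff by blast

text \<open>The homomorphism equation is used for the outer operation and for each inner one. Both
  directions of the kernel criterion need this for the right-hand side of the composition
  law.\<close>

lemma cinf_hom_ops_comp:
  assumes M: "cinf_structure M" and q: "q \<in> cinf_hom M N"
    and f: "f \<in> smooth_funs n" and g: "\<forall>i<n. g i \<in> smooth_funs k" and as: "as \<in> tuples (car M) k"
  shows "q (ops M n f (map (\<lambda>i. ops M k (g i) as) [0..<n]))
    = ops N n f (map (\<lambda>i. ops N k (g i) (map q as)) [0..<n])"
proof -
  have "map (\<lambda>i. ops M k (g i) as) [0..<n] \<in> tuples (car M) n"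
    using ops_closed[OF M _ as] g by (intro map_upt_in_tuples) blast
  moreover have "map q (map (\<lambda>i. ops M k (g i) as) [0..<n])
      = map (\<lambda>i. ops N k (g i) (map q as)) [0..<n]"
    using g cinf_hom_ops[OF q _ as] by simp
  ultimately show ?thesis
    using cinf_hom_ops[OF q f] by metis
qed

text \<open>The laws of \<open>N\<close> are used only at tuples \<open>map q as\<close>, so an
  arbitrary homomorphism into a ring will do, as the universal property requires.\<close>

lemma ring_laws_hom_kernel:
  assumes M: "cinf_structure M" and q: "q \<in> cinf_hom M N" and N: "cinf_ring N"
  shows "ring_laws M (hom_kernel M q)"
  unfolding ring_laws_def
proof (intro conjI allI ballI impI)
  fix n k as assume k: "k < n" and as: "as \<in> tuples (car M) n"
  have "map q as \<in> tuples (car N) n"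
    using as cinf_hom_closed[OF q] by (rule map_in_tuples)
  then have "ops N n (coord n k) (map q as) = map q as ! k"
    using N k by (simp add: cinf_ring_def)
  moreover have "map q as ! k = q (as ! k)"
    using as k by (simp add: tuples_def)
  ultimately show "(ops M n (coord n k) as, as ! k) \<in> hom_kernel M q"
    using cinf_hom_ops[OF q coord_smooth as] ops_closed[OF M coord_smooth as] tuples_nth[OF as k]
    by (simp add: hom_kernel_def)
next
  fix n k f g h as
  assume f: "f \<in> smooth_funs n" and g: "\<forall>i<n. g i \<in> smooth_funs k" and h: "h \<in> smooth_funs k"
    and eq: "\<forall>x\<in>topspace (Euclidean_space k). h x = f (map_tuple n g x)"
    and as: "as \<in> tuples (car M) k"
  have "map q as \<in> tuples (car N) k"
    using as cinf_hom_closed[OF q] by (rule map_in_tuples)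
  then have "ops N k h (map q as) = ops N n f (map (\<lambda>i. ops N k (g i) (map q as)) [0..<n])"
    using N f g h eq unfolding cinf_ring_def by blast
  then have "q (ops M k h as) = q (ops M n f (map (\<lambda>i. ops M k (g i) as) [0..<n]))"
    using cinf_hom_ops[OF q h as] cinf_hom_ops_comp[OF M q f g as] by simp
  moreover have "map (\<lambda>i. ops M k (g i) as) [0..<n] \<in> tuples (car M) n"
    using ops_closed[OF M _ as] g by (intro map_upt_in_tuples) blast
  ultimately show "(ops M k h as, ops M n f (map (\<lambda>i. ops M k (g i) as) [0..<n])) \<in> hom_kernel M q"
    using ops_closed[OF M h as] ops_closed[OF M f] by (simp add: hom_kernel_def)
qed

text \<open>Converse of \<open>ring_laws_hom_kernel\<close> for surjective \<open>q\<close>: each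
  tuple of \<open>N\<close> is some \<open>map q as\<close>, where the kernel condition gives the
  law.\<close>

lemma cinf_ring_if_ring_laws:
  assumes M: "cinf_structure M" and N: "cinf_structure N"
    and q: "q \<in> cinf_hom M N" and surj: "q ` car M = car N"
    and laws: "ring_laws M (hom_kernel M q)"
  shows "cinf_ring N"
  unfolding cinf_ring_def
proof (intro conjI allI ballI impI)
  fix n k bs assume k: "k < n" and "bs \<in> tuples (car N) n"
  then obtain as where as: "as \<in> tuples (car M) n" and bs: "bs = map q as"
    using tuples_image[of bs q "car M" n] surj by auto
  have "q (ops M n (coord n k) as) = q (as ! k)"
    using laws k as by (simp add: ring_laws_def hom_kernel_def)
  moreover have "bs ! k = q (as ! k)"
    using as k bs by (simp add: tuples_def)
  ultimately show "ops N n (coord n k) bs = bs ! k"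
    using cinf_hom_ops[OF q coord_smooth as] bs by simp
next
  fix n k f g h bs
  assume f: "f \<in> smooth_funs n" and g: "\<forall>i<n. g i \<in> smooth_funs k" and h: "h \<in> smooth_funs k"
    and eq: "\<forall>x\<in>topspace (Euclidean_space k). h x = f (map_tuple n g x)"
    and "bs \<in> tuples (car N) k"
  then obtain as where as: "as \<in> tuples (car M) k" and bs: "bs = map q as"
    using tuples_image[of bs q "car M" k] surj by auto
  have "(ops M k h as, ops M n f (map (\<lambda>i. ops M k (g i) as) [0..<n])) \<in> hom_kernel M q"
    using laws f g h eq as unfolding ring_laws_def by blast
  then show "ops N k h bs = ops N n f (map (\<lambda>i. ops N k (g i) bs) [0..<n])"
    using cinf_hom_ops[OF q h as] cinf_hom_ops_comp[OF M q f g as] bs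
    by (simp add: hom_kernel_def)
qed (rule N)

text \<open>The factor sends \<open>q a\<close> to \<open>f a\<close>: the kernel inclusion makes
  this well defined, and surjectivity of \<open>q\<close> makes it defined on all of
  \<open>car Q\<close> and unique.\<close>

lemma cinf_hom_factor:
  assumes M: "cinf_structure M" and q: "q \<in> cinf_hom M Q" and surj: "q ` car M = car Q"
    and f: "f \<in> cinf_hom M N" and ker: "hom_kernel M q \<subseteq> hom_kernel M f"
  shows "\<exists>!g. g \<in> cinf_hom Q N \<and> compose (car M) g q = f"
proof (rule ex1I)
  \<comment> \<open>The value is read off at a chosen preimage; the restriction to
    \<open>car Q\<close> gives the extensionality that homomorphisms must have.\<close>
  define g where "g = (\<lambda>b\<in>car Q. f (inv_into (car M) q b))"
  have gq: "g (q a) = f a" if a: "a \<in> car M" for a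
  proof -
    have "q a \<in> q ` car M"
      using a by blast
    then have "(inv_into (car M) q (q a), a) \<in> hom_kernel M q"
      using a by (simp add: hom_kernel_def inv_into_into f_inv_into_f)
    then have "f (inv_into (car M) q (q a)) = f a"
      using ker by (auto simp: hom_kernel_def)
    then show ?thesis
      using cinf_hom_closed[OF q a] by (simp add: g_def)
  qed
  have "g (ops Q n h bs) = ops N n h (map g bs)"
    if h: "h \<in> smooth_funs n" and "bs \<in> tuples (car Q) n" for n h bs
  proof -
    obtain as where as: "as \<in> tuples (car M) n" and bs: "bs = map q as"
      using tuples_image[of bs q "car M" n] surj \<open>bs \<in> tuples (car Q) n\<close> by auto
    have "g (ops Q n h bs) = f (ops M n h as)"
      using gq[OF ops_closed[OF M h as]] cinf_hom_ops[OF q h as] bs by simp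
    moreover have "map f as = map g bs"
      using as bs gq by (auto simp: tuples_def in_lists_conv_set)
    ultimately show ?thesis
      using cinf_hom_ops[OF f h as] by simp
  qed
  moreover have "g b \<in> car N" if "b \<in> car Q" for b
    using that gq cinf_hom_closed[OF f] surj by force
  then have "g \<in> car Q \<rightarrow>\<^sub>E car N"
    by (auto simp: g_def)
  ultimately have "g \<in> cinf_hom Q N"
    by (simp add: cinf_hom_def)
  moreover have "compose (car M) g q = f"
    using cinf_hom_extensional[OF f] gq
    by (intro extensionalityI[OF compose_extensional]) (auto simp: compose_def)
  ultimately show "g \<in> cinf_hom Q N \<and> compose (car M) g q = f"
    by blast
  fix g' assume g': "g' \<in> cinf_hom Q N \<and> compose (car M) g' q = f"
  show "g' = g"
  \<comment> \<open>Equality is of total functions: off \<open>car Q\<close> both are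
    \<open>undefined\<close>, on it every point is some \<open>q a\<close>.\<close>
  proof (rule extensionalityI)
    show "g' \<in> extensional (car Q)"
      using g' cinf_hom_extensional by blast
    show "g \<in> extensional (car Q)"
      by (simp add: g_def)
    fix b assume "b \<in> car Q"
    then obtain a where a: "a \<in> car M" "b = q a"
      using surj by blast
    have "compose (car M) g' q a = f a"
      using g' by simp
    then show "g' b = g b"
      using a gq by (simp add: compose_def)
  qed
qed


section \<open>Quotients\<close>

lemma cinf_congruence_hom_kernel:
  assumes M: "cinf_structure M" and q: "q \<in> cinf_hom M N"
  shows "cinf_congruence M (hom_kernel M q)"
  unfolding cinf_congruence_def
proof (intro conjI allI ballI impI)
  show "equiv (car M) (hom_kernel M q)"
    by (auto simp: hom_kernel_def equiv_def refl_on_def sym_def trans_def)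
  fix n f xs ys
  assume f: "f \<in> smooth_funs n" and len: "length xs = n"
    and xy: "list_all2 (\<lambda>x y. (x, y) \<in> hom_kernel M q) xs ys"
  \<comment> \<open>\<open>cinf_congruence\<close> admits arbitrary lists; that these consist of
    carrier elements comes from the kernel being confined to \<open>car M\<close>.\<close>
  have xs: "xs \<in> tuples (car M) n" and ys: "ys \<in> tuples (car M) n" and "map q xs = map q ys"
    using xy len
    by (auto simp: hom_kernel_def list_all2_conv_all_nth tuples_def in_lists_conv_set
        in_set_conv_nth intro: nth_equalityI)
  then show "(ops M n f xs, ops M n f ys) \<in> hom_kernel M q"
    using cinf_hom_ops[OF q f xs] cinf_hom_ops[OF q f ys] ops_closed[OF M f xs] ops_closed[OF M f ys]
    by (simp add: hom_kernel_def)
qed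

text \<open>Written as an image so that \<open>tuples_image\<close> lifts tuples of classes to
  tuples of representatives, where \<open>ops_cinf_quotient\<close> evaluates the
  operations.\<close>

lemma car_cinf_quotient: "car (cinf_quotient M \<theta>) = (\<lambda>a. \<theta> `` {a}) ` car M"
  by (auto simp: cinf_quotient_def quotient_def)

lemma cinf_structure_quotient:
  assumes M: "cinf_structure M" and \<theta>: "cinf_congruence M \<theta>"
  shows "cinf_structure (cinf_quotient M \<theta>)"
  unfolding cinf_structure_def
proof (intro allI PiE_I)
  fix n f Xs
  assume f: "f \<in> smooth_funs n" and "Xs \<in> tuples (car (cinf_quotient M \<theta>)) n"
  then obtain as where as: "as \<in> tuples (car M) n" and Xs: "Xs = map (\<lambda>a. \<theta> `` {a}) as"
    unfolding car_cinf_quotient using tuples_image by blast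
  show "ops (cinf_quotient M \<theta>) n f Xs \<in> car (cinf_quotient M \<theta>)"
    unfolding Xs ops_cinf_quotient[OF M \<theta> f as] car_cinf_quotient
    using ops_closed[OF M f as] by blast
\<comment> \<open>What is left is the value \<open>undefined\<close> off smooth functions and off
  tuples of classes, built into \<open>cinf_quotient\<close> by its restrictions.\<close>
qed (auto simp: cinf_quotient_def)

lemma quotient_hom_surj: "quotient_hom M \<theta> ` car M = car (cinf_quotient M \<theta>)"
  by (auto simp: quotient_hom_def car_cinf_quotient)

lemma quotient_hom_in_hom:
  assumes M: "cinf_structure M" and \<theta>: "cinf_congruence M \<theta>"
  shows "quotient_hom M \<theta> \<in> cinf_hom M (cinf_quotient M \<theta>)"
proof -
  have "quotient_hom M \<theta> (ops M n f as) = ops (cinf_quotient M \<theta>) n f (map (quotient_hom M \<theta>) as)"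
    if f: "f \<in> smooth_funs n" and as: "as \<in> tuples (car M) n" for n f as
  proof -
    have map_q: "map (quotient_hom M \<theta>) as = map (\<lambda>a. \<theta> `` {a}) as"
      using as by (auto simp: quotient_hom_def tuples_def in_lists_conv_set)
    show ?thesis
      unfolding map_q ops_cinf_quotient[OF M \<theta> f as]
      using ops_closed[OF M f as] by (simp add: quotient_hom_def)
  qed
  moreover have "quotient_hom M \<theta> \<in> car M \<rightarrow>\<^sub>E car (cinf_quotient M \<theta>)"
    by (auto simp: quotient_hom_def car_cinf_quotient)
  ultimately show ?thesis
    by (simp add: cinf_hom_def)
qed

section \<open>Congruences with ring quotient and the least one\<close>

lemma hom_kernel_quotient_hom:
  assumes \<theta>: "cinf_congruence M \<theta>"
  shows "hom_kernel M (quotient_hom M \<theta>) = \<theta>"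
proof -
  have eq: "equiv (car M) \<theta>"
    using \<theta> by (simp add: cinf_congruence_def)
  have "(x, y) \<in> hom_kernel M (quotient_hom M \<theta>) \<longleftrightarrow> (x, y) \<in> \<theta>" for x y
    unfolding equiv_class_eq_iff[OF eq, of x y] by (auto simp: hom_kernel_def quotient_hom_def)
  then show ?thesis
    by (intro set_eqI) (simp add: split_paired_all)
qed

text \<open>Both kernel criteria are applied to the quotient map, whose kernel is
  \<open>\<theta>\<close>. A condition on the quotient becomes one on the relation itself that is
  stable under intersection.\<close>

lemma rng_congruence_iff_ring_laws:
  assumes M: "cinf_structure M"
  shows "rng_congruence M \<theta> \<longleftrightarrow> cinf_congruence M \<theta> \<and> ring_laws M \<theta>"
proof (cases "cinf_congruence M \<theta>")
  case True
  note q = quotient_hom_in_hom[OF M True]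
  show ?thesis
    using True ring_laws_hom_kernel[OF M q] hom_kernel_quotient_hom[OF True]
      cinf_ring_if_ring_laws[OF M cinf_structure_quotient[OF M True] q quotient_hom_surj]
    by (auto simp: rng_congruence_def)
qed (simp add: rng_congruence_def)

lemma cinf_congruence_Inter:
  assumes ne: "\<Theta> \<noteq> {}" and \<Theta>: "\<And>\<theta>. \<theta> \<in> \<Theta> \<Longrightarrow> cinf_congruence M \<theta>"
  shows "cinf_congruence M (\<Inter>\<Theta>)"
  unfolding cinf_congruence_def
proof (intro conjI allI ballI impI)
  have eq: "equiv (car M) \<theta>" if "\<theta> \<in> \<Theta>" for \<theta>
    using \<Theta>[OF that] by (simp add: cinf_congruence_def)
  show "equiv (car M) (\<Inter>\<Theta>)"
  proof (rule equivI)
    \<comment> \<open>Nonemptiness enters here: the empty intersection would contain all pairs of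
      the type.\<close>
    show "\<Inter>\<Theta> \<subseteq> car M \<times> car M"
      using ne eq by (auto simp: equiv_def)
    show "refl_on (car M) (\<Inter>\<Theta>)"
      using eq by (auto simp: equiv_def refl_on_def)
    show "sym (\<Inter>\<Theta>)"
      using eq by (auto simp: equiv_def intro!: symI dest: symD)
    show "trans (\<Inter>\<Theta>)"
      using eq by (meson InterE InterI equivE transI transD)
  qed
  fix n f xs ys
  assume f: "f \<in> smooth_funs n" and len: "length xs = n"
    and xy: "list_all2 (\<lambda>x y. (x, y) \<in> \<Inter>\<Theta>) xs ys"
  show "(ops M n f xs, ops M n f ys) \<in> \<Inter>\<Theta>"
  proof
    fix \<theta> assume \<theta>: "\<theta> \<in> \<Theta>"
    have "list_all2 (\<lambda>x y. (x, y) \<in> \<theta>) xs ys"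
      using xy by (rule list_all2_mono) (use \<theta> in blast)
    then show "(ops M n f xs, ops M n f ys) \<in> \<theta>"
      using \<Theta>[OF \<theta>] f len unfolding cinf_congruence_def by blast
  qed
qed

text \<open>Makes the family intersected in \<open>theta_least\<close> nonempty. With all carrier
  elements related, the conditions amount to closure under the operations.\<close>

lemma rng_congruence_full:
  assumes M: "cinf_structure M"
  shows "rng_congruence M (car M \<times> car M)"
proof -
  have "cinf_congruence M (car M \<times> car M)"
    unfolding cinf_congruence_def
  proof (intro conjI allI ballI impI)
    show "equiv (car M) (car M \<times> car M)"
      by (auto simp: equiv_def refl_on_def sym_def trans_def)
    fix n f xs ys
    assume f: "f \<in> smooth_funs n" and len: "length xs = n"
      and xy: "list_all2 (\<lambda>x y. (x, y) \<in> car M \<times> car M) xs ys"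
    have "xs \<in> tuples (car M) n" "ys \<in> tuples (car M) n"
      using xy len by (auto simp: list_all2_conv_all_nth tuples_def in_lists_conv_set in_set_conv_nth)
    then show "(ops M n f xs, ops M n f ys) \<in> car M \<times> car M"
      using ops_closed[OF M f] by blast
  qed
  moreover have "ring_laws M (car M \<times> car M)"
    unfolding ring_laws_def
    using M by (auto intro!: ops_closed[OF M] coord_smooth tuples_nth map_upt_in_tuples)
  ultimately show ?thesis
    using rng_congruence_iff_ring_laws[OF M] by blast
qed

text \<open>\<open>LEAST\<close> has the intended meaning only if a least element exists; the
  intersection of all these congruences is again one of them, hence that element.\<close>

lemma theta_least:
  assumes M: "cinf_structure M"
  shows "rng_congruence M (theta M)" and "rng_congruence M \<theta> \<Longrightarrow> theta M \<subseteq> \<theta>"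
proof -
  let ?\<Theta> = "{\<theta>. rng_congruence M \<theta>}"
  have least: "rng_congruence M (\<Inter>?\<Theta>)"
  proof -
    have "cinf_congruence M (\<Inter>?\<Theta>)"
      using rng_congruence_full[OF M] by (intro cinf_congruence_Inter) (auto simp: rng_congruence_def)
    moreover have "ring_laws M (\<Inter>?\<Theta>)"
      using rng_congruence_iff_ring_laws[OF M] by (intro ring_laws_Inter) blast
    ultimately show ?thesis
      using rng_congruence_iff_ring_laws[OF M] by blast
  qed
  have "theta M = \<Inter>?\<Theta>"
    unfolding theta_def by (rule Least_equality) (use least in auto)
  then show "rng_congruence M (theta M)" and "rng_congruence M \<theta> \<Longrightarrow> theta M \<subseteq> \<theta>"
    using least by auto
qed


section \<open>Transport of structure\<close>

text \<open>\<open>transport\<close> applies the operations of \<open>N\<close> after undoing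
  \<open>c\<close>; by injectivity, \<open>inv_into\<close> returns exactly the original tuple. The
  map is restricted because homomorphisms are extensional.\<close>

lemma transport_hom:
  assumes N: "cinf_structure N" and c: "inj_on c (car N)"
  shows "restrict c (car N) \<in> cinf_hom N (transport c N)"
proof -
  have "restrict c (car N) (ops N n f as) = ops (transport c N) n f (map (restrict c (car N)) as)"
    if f: "f \<in> smooth_funs n" and as: "as \<in> tuples (car N) n" for n f as
  proof -
    have map_c: "map (restrict c (car N)) as = map c as"
      using as by (auto simp: tuples_def in_lists_conv_set)
    have "map c as \<in> tuples (c ` car N) n"
      using as by (rule map_in_tuples) blast
    then have ops_c: "ops (transport c N) n f (map c as) = c (ops N n f (map (inv_into (car N) c) (map c as)))"
      using f by (simp add: transport_def del: map_map)
    have inv_c: "map (inv_into (car N) c) (map c as) = as"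
      unfolding map_map using as inv_into_f_f[OF c]
      by (intro map_idI) (simp add: tuples_def in_lists_conv_set)
    show ?thesis
      unfolding map_c ops_c inv_c using ops_closed[OF N f as] by simp
  qed
  moreover have "restrict c (car N) \<in> car N \<rightarrow>\<^sub>E car (transport c N)"
    by (auto simp: transport_def)
  ultimately show ?thesis
    by (simp add: cinf_hom_def)
qed

lemma cinf_structure_transport:
  assumes N: "cinf_structure N" and c: "inj_on c (car N)"
  shows "cinf_structure (transport c N)"
  unfolding cinf_structure_def
proof (intro allI PiE_I)
  fix n f bs assume f: "f \<in> smooth_funs n" and bs: "bs \<in> tuples (car (transport c N)) n"
  have "map (inv_into (car N) c) bs \<in> tuples (car N) n"
    using bs by (rule map_in_tuples) (auto simp: transport_def c)
  then show "ops (transport c N) n f bs \<in> car (transport c N)"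
    using f bs ops_closed[OF N f] by (simp add: transport_def)
qed (auto simp: transport_def)


section \<open>Reflective subcategories\<close>

lemma is_category_full_subcat: "is_category C \<Longrightarrow> is_category (full_subcat C P)"
  by (simp add: is_category_def full_subcat_def)

text \<open>Universal arrows into objects satisfying \<open>P\<close> determine the adjunction:
  precomposition with \<open>q X\<close> is the bijection of hom-sets, and the left adjoint acts on
  arrows by unique factorisation.\<close>

lemma adjunction_of_universal_arrows:
  assumes C: "is_category C"
    and r: "\<And>X. X \<in> obj C \<Longrightarrow> r X \<in> obj C \<and> P (r X)"
    and q: "\<And>X. X \<in> obj C \<Longrightarrow> q X \<in> hom C X (r X)"
    and univ: "\<And>X Y f. X \<in> obj C \<Longrightarrow> Y \<in> obj C \<Longrightarrow> P Y \<Longrightarrow> f \<in> hom C X Y \<Longrightarrow>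
        \<exists>!g. g \<in> hom C (r X) Y \<and> cmp C X (r X) Y g (q X) = f"
  shows "\<exists>L. adjunction C (full_subcat C P) L inclusion (\<lambda>X Y \<psi>. cmp C X (r X) Y \<psi> (q X))
    \<and> fob L = r"
proof -
  \<comment> \<open>The action on arrows is forced: it is the only one making \<open>q\<close>
    natural.\<close>
  define la where "la X Y f = (THE g. g \<in> hom C (r X) (r Y) \<and>
      cmp C X (r X) (r Y) g (q X) = cmp C X Y (r Y) (q Y) f)" for X Y f
  have comp: "cmp C X Y Z g f \<in> hom C X Z"
    if "X \<in> obj C" "Y \<in> obj C" "Z \<in> obj C" "f \<in> hom C X Y" "g \<in> hom C Y Z" for X Y Z f g
    using C that unfolding is_category_def by blast
  have assoc: "cmp C W Y Z h (cmp C W X Y g f) = cmp C W X Z (cmp C X Y Z h g) f"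
    if "W \<in> obj C" "X \<in> obj C" "Y \<in> obj C" "Z \<in> obj C"
      "f \<in> hom C W X" "g \<in> hom C X Y" "h \<in> hom C Y Z" for W X Y Z f g h
    using C that unfolding is_category_def by blast
  have idn: "idn C X \<in> hom C X X" if "X \<in> obj C" for X
    using C that unfolding is_category_def by blast
  have idl: "cmp C X Y Y (idn C Y) f = f" and idr: "cmp C X X Y f (idn C X) = f"
    if "X \<in> obj C" "Y \<in> obj C" "f \<in> hom C X Y" for X Y f
    using C that unfolding is_category_def by blast+
  have r1: "r X \<in> obj C" and r2: "P (r X)" if "X \<in> obj C" for X
    using r[OF that] by blast+
  have univ_q: "\<exists>!g. g \<in> hom C (r X) (r Y) \<and>
      cmp C X (r X) (r Y) g (q X) = cmp C X Y (r Y) (q Y) f"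
    if X: "X \<in> obj C" and Y: "Y \<in> obj C" and f: "f \<in> hom C X Y" for X Y f
    by (rule univ[OF X r1[OF Y] r2[OF Y] comp[OF X Y r1[OF Y] f q[OF Y]]])
  have la: "la X Y f \<in> hom C (r X) (r Y)"
    and la_q: "cmp C X (r X) (r Y) (la X Y f) (q X) = cmp C X Y (r Y) (q Y) f"
    if "X \<in> obj C" "Y \<in> obj C" "f \<in> hom C X Y" for X Y f
    using theI'[OF univ_q[OF that]] unfolding la_def by blast+
  \<comment> \<open>Both functor laws follow by uniqueness: the proposed value only has to solve the
    same factorisation equation.\<close>
  have la_eqI: "la X Y f = g"
    if "X \<in> obj C" "Y \<in> obj C" "f \<in> hom C X Y" "g \<in> hom C (r X) (r Y)"
      "cmp C X (r X) (r Y) g (q X) = cmp C X Y (r Y) (q Y) f" for X Y f g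
    unfolding la_def by (rule the1_equality[OF univ_q[OF that(1-3)]]) (use that(4,5) in blast)
  have la_id: "la X X (idn C X) = idn C (r X)" if X: "X \<in> obj C" for X
    using idl[OF X r1[OF X] q[OF X]] idr[OF X r1[OF X] q[OF X]]
    by (intro la_eqI[OF X X idn[OF X] idn[OF r1[OF X]]]) simp
  have la_comp: "la X Z (cmp C X Y Z g f) = cmp C (r X) (r Y) (r Z) (la Y Z g) (la X Y f)"
    if X: "X \<in> obj C" and Y: "Y \<in> obj C" and Z: "Z \<in> obj C"
      and f: "f \<in> hom C X Y" and g: "g \<in> hom C Y Z" for X Y Z f g
  proof (rule la_eqI)
    note rs = r1[OF X] r1[OF Y] r1[OF Z]
    note laf = la[OF X Y f] and lag = la[OF Y Z g]
    show "cmp C (r X) (r Y) (r Z) (la Y Z g) (la X Y f) \<in> hom C (r X) (r Z)"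
      by (rule comp[OF rs laf lag])
    \<comment> \<open>The naturality squares of \<open>q\<close> at \<open>f\<close> and at
      \<open>g\<close> are pasted by associativity.\<close>
    have "cmp C X (r X) (r Z) (cmp C (r X) (r Y) (r Z) (la Y Z g) (la X Y f)) (q X)
        = cmp C X (r Y) (r Z) (la Y Z g) (cmp C X (r X) (r Y) (la X Y f) (q X))"
      by (rule assoc[OF X rs q[OF X] laf lag, symmetric])
    also have "\<dots> = cmp C X (r Y) (r Z) (la Y Z g) (cmp C X Y (r Y) (q Y) f)"
      by (simp only: la_q[OF X Y f])
    also have "\<dots> = cmp C X Y (r Z) (cmp C Y (r Y) (r Z) (la Y Z g) (q Y)) f"
      by (rule assoc[OF X Y rs(2,3) f q[OF Y] lag])
    also have "\<dots> = cmp C X Y (r Z) (cmp C Y Z (r Z) (q Z) g) f"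
      by (simp only: la_q[OF Y Z g])
    also have "\<dots> = cmp C X Z (r Z) (q Z) (cmp C X Y Z g f)"
      by (rule assoc[OF X Y Z rs(3) f g q[OF Z], symmetric])
    finally show "cmp C X (r X) (r Z) (cmp C (r X) (r Y) (r Z) (la Y Z g) (la X Y f)) (q X)
        = cmp C X Z (r Z) (q Z) (cmp C X Y Z g f)" .
  qed (rule X Z comp[OF X Y Z f g])+
  \<comment> \<open>Injectivity is the uniqueness of the factorisation through \<open>q X\<close>,
    surjectivity its existence.\<close>
  have bij: "bij_betw (\<lambda>\<psi>. cmp C X (r X) Y \<psi> (q X)) (hom C (r X) Y) (hom C X Y)"
    if "X \<in> obj C" "Y \<in> obj C" "P Y" for X Y
  proof (rule bij_betwI')
    fix \<psi> assume "\<psi> \<in> hom C (r X) Y"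
    then show \<psi>q: "cmp C X (r X) Y \<psi> (q X) \<in> hom C X Y"
      using that r q comp by blast
    fix \<psi>' assume "\<psi>' \<in> hom C (r X) Y"
    then show "cmp C X (r X) Y \<psi> (q X) = cmp C X (r X) Y \<psi>' (q X) \<longleftrightarrow> \<psi> = \<psi>'"
      using univ[OF that \<psi>q] \<open>\<psi> \<in> hom C (r X) Y\<close> by metis
  next
    fix f assume "f \<in> hom C X Y"
    then show "\<exists>\<psi>\<in>hom C (r X) Y. f = cmp C X (r X) Y \<psi> (q X)"
      using univ[OF that] by metis
  qed
  \<comment> \<open>Naturality in the first variable: associativity on both sides of the square
    \<open>la_q\<close> at \<open>u\<close>.\<close>
  have natural: "cmp C X' (r X') Y (cmp C (r X') (r X) Y \<psi> (la X' X u)) (q X')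
      = cmp C X' X Y (cmp C X (r X) Y \<psi> (q X)) u"
    if X: "X \<in> obj C" and X': "X' \<in> obj C" and Y: "Y \<in> obj C"
      and u: "u \<in> hom C X' X" and \<psi>: "\<psi> \<in> hom C (r X) Y" for X X' Y u \<psi>
    using assoc[OF X' r1[OF X'] r1[OF X] Y q[OF X'] la[OF X' X u] \<psi>]
      assoc[OF X' X r1[OF X] Y u q[OF X] \<psi>] la_q[OF X' X u] by simp
  let ?L = "\<lparr>fob = r, far = la\<rparr>"
  have L: "is_functor C (full_subcat C P) ?L"
    using r1 r2 la la_id la_comp by (simp add: is_functor_def full_subcat_def)
  have incl: "is_functor (full_subcat C P) C inclusion"
    by (simp add: is_functor_def full_subcat_def inclusion_def)
  have "adjunction C (full_subcat C P) ?L inclusion (\<lambda>X Y \<psi>. cmp C X (r X) Y \<psi> (q X))"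
    unfolding adjunction_def
  proof (intro conjI ballI C is_category_full_subcat L incl)
    fix X Y assume "X \<in> obj C" "Y \<in> obj (full_subcat C P)"
    then show "bij_betw (\<lambda>\<psi>. cmp C X (r X) Y \<psi> (q X))
        (hom (full_subcat C P) (fob ?L X) Y) (hom C X (fob inclusion Y))"
      using bij by (simp add: full_subcat_def inclusion_def)
  next
    fix X X' Y u \<psi>
    assume "X \<in> obj C" "X' \<in> obj C" "Y \<in> obj (full_subcat C P)"
      "u \<in> hom C X' X" "\<psi> \<in> hom (full_subcat C P) (fob ?L X) Y"
    then show "cmp C X' (r X') Y (cmp (full_subcat C P) (fob ?L X') (fob ?L X) Y \<psi> (far ?L X' X u)) (q X')
        = cmp C X' X (fob inclusion Y) (cmp C X (r X) Y \<psi> (q X)) u"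
      using natural by (simp add: full_subcat_def inclusion_def)
  next
    \<comment> \<open>Naturality in the second variable is associativity alone, as the inclusion
      leaves arrows unchanged.\<close>
    fix X Y Y' v \<psi>
    assume X: "X \<in> obj C" and "Y \<in> obj (full_subcat C P)" "Y' \<in> obj (full_subcat C P)"
      "v \<in> hom (full_subcat C P) Y Y'" "\<psi> \<in> hom (full_subcat C P) (fob ?L X) Y"
    then show "cmp C X (r X) Y' (cmp (full_subcat C P) (fob ?L X) Y Y' v \<psi>) (q X)
        = cmp C X (fob inclusion Y) (fob inclusion Y') (far inclusion Y Y' v) (cmp C X (r X) Y \<psi> (q X))"
      using assoc[OF X r1[OF X] _ _ q[OF X]] by (simp add: full_subcat_def inclusion_def)
  qed
  moreover have "fob ?L = r"
    by simp
  ultimately show ?thesis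
    by (intro exI conjI)
qed


section \<open>The reflection of smooth structures\<close>

text \<open>Composition is restricted to the source carrier, so the identity laws rest on
  homomorphisms being extensional, and associativity on the first map landing in the carrier of its
  target.\<close>

lemma is_category_CinfStr:
  fixes U :: "'u set set"
  shows "is_category (CinfStr U)"
proof -
  have id: "(\<lambda>a\<in>car M. a) \<in> cinf_hom M M" if M: "cinf_structure M" for M :: "'u cinf"
  proof -
    have "map (\<lambda>a\<in>car M. a) as = as" if "as \<in> tuples (car M) n" for as n
      using that by (intro map_idI) (auto simp: tuples_def in_lists_conv_set)
    then show ?thesis
      using ops_closed[OF M] by (auto simp: cinf_hom_def)
  qed
  have idl: "compose (car M) (\<lambda>a\<in>car N. a) f = f" and idr: "compose (car M) f (\<lambda>a\<in>car M. a) = f"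
    if f: "f \<in> cinf_hom M N" for M N :: "'u cinf" and f
  proof -
    have "f \<in> car M \<rightarrow> car N"
      using cinf_hom_closed[OF f] by blast
    then show "compose (car M) (\<lambda>a\<in>car N. a) f = f" "compose (car M) f (\<lambda>a\<in>car M. a) = f"
      using cinf_hom_extensional[OF f] by (rule Id_compose, rule compose_Id)
  qed
  have assoc: "compose (car M) h (compose (car M) g f) = compose (car M) (compose (car N) h g) f"
    if f: "f \<in> cinf_hom M N" for M N :: "'u cinf" and f g h :: "'u \<Rightarrow> 'u"
  proof -
    have "f \<in> car M \<rightarrow> car N"
      using cinf_hom_closed[OF f] by blast
    then show ?thesis
      by (rule compose_assoc)
  qed
  show ?thesis
    unfolding is_category_def
    by (intro conjI ballI; simp only: CinfStr_def cat.simps mem_Collect_eq)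
      (blast intro: id cinf_hom_compose idl idr assoc)+
qed

text \<open>Since \<open>c\<close> is injective, \<open>q\<close> has kernel \<open>theta M\<close>,
  so the criteria for surjections apply to \<open>Q\<close> directly. The kernel of a homomorphism
  to a ring is one of the congruences that contain \<open>theta M\<close>, hence the homomorphism
  factors.\<close>

lemma transport_quotient_universal:
  fixes M :: "'a cinf" and c :: "'a set \<Rightarrow> 'b"
  assumes M: "cinf_structure M" and c: "inj_on c (car (cinf_quotient M (theta M)))"
  defines "Q \<equiv> transport c (cinf_quotient M (theta M))"
    and "q \<equiv> compose (car M) c (quotient_hom M (theta M))"
  shows "cinf_ring Q" and "q \<in> cinf_hom M Q"
    and "cinf_ring N \<Longrightarrow> f \<in> cinf_hom M N \<Longrightarrow>
      \<exists>!g. g \<in> cinf_hom Q N \<and> compose (car M) g q = f"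
proof -
  let ?\<theta> = "theta M"
  let ?N = "cinf_quotient M ?\<theta>"
  have \<theta>: "cinf_congruence M ?\<theta>" "ring_laws M ?\<theta>"
    using theta_least(1)[OF M] unfolding rng_congruence_iff_ring_laws[OF M] by blast+
  note N = cinf_structure_quotient[OF M \<theta>(1)] and p = quotient_hom_in_hom[OF M \<theta>(1)]
  \<comment> \<open>\<open>transport_hom\<close> concerns the restriction of \<open>c\<close>; the
    composite is the same because the quotient map lands in the carrier.\<close>
  have "q = compose (car M) (restrict c (car ?N)) (quotient_hom M ?\<theta>)"
    unfolding q_def compose_def using cinf_hom_closed[OF p] by (intro restrict_ext) simp
  then show q: "q \<in> cinf_hom M Q"
    using cinf_hom_compose[OF M p transport_hom[OF N c]] by (simp add: Q_def)
  have surj: "q ` car M = car Q"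
    using quotient_hom_surj[of M ?\<theta>] by (simp add: q_def Q_def transport_def compose_def flip: image_image)
  have "q x = q y \<longleftrightarrow> quotient_hom M ?\<theta> x = quotient_hom M ?\<theta> y" if "x \<in> car M" "y \<in> car M" for x y
    using that inj_on_eq_iff[OF c cinf_hom_closed[OF p] cinf_hom_closed[OF p]]
    by (simp add: q_def compose_def)
  then have "hom_kernel M q = hom_kernel M (quotient_hom M ?\<theta>)"
    unfolding hom_kernel_def by blast
  then have ker: "hom_kernel M q = ?\<theta>"
    unfolding hom_kernel_quotient_hom[OF \<theta>(1)] .
  have "cinf_structure Q"
    unfolding Q_def by (rule cinf_structure_transport[OF N c])
  then show "cinf_ring Q"
    using q surj by (rule cinf_ring_if_ring_laws[OF M]) (simp only: ker \<theta>(2))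
  assume "cinf_ring N" and f: "f \<in> cinf_hom M N"
  then have "rng_congruence M (hom_kernel M f)"
    unfolding rng_congruence_iff_ring_laws[OF M]
    by (intro conjI cinf_congruence_hom_kernel[OF M f] ring_laws_hom_kernel[OF M f])
  then have "hom_kernel M q \<subseteq> hom_kernel M f"
    unfolding ker by (rule theta_least(2)[OF M])
  then show "\<exists>!g. g \<in> cinf_hom Q N \<and> compose (car M) g q = f"
    by (rule cinf_hom_factor[OF M q surj f])
qed

theorem theorem6:
  fixes U :: "'u set set" and c :: "'u set \<Rightarrow> 'u"
  assumes "quotient_universe U c"
  shows "(\<forall>M :: 'u cinf. cinf_structure M \<longrightarrow>
            rng_congruence M (theta M) \<and>
            (\<forall>\<theta>. rng_congruence M \<theta> \<longrightarrow> theta M \<subseteq> \<theta>)) \<and>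
         (\<exists>L \<Phi>. adjunction (CinfStr U) (CinfRng U) L inclusion \<Phi> \<and>
            (\<forall>M\<in>obj (CinfStr U).
               fob L M = transport c (cinf_quotient M (theta M)) \<and>
               adj_unit (CinfRng U) L \<Phi> M
                 = compose (car M) c (quotient_hom M (theta M))))"
proof
  show "\<forall>M :: 'u cinf. cinf_structure M \<longrightarrow>
      rng_congruence M (theta M) \<and> (\<forall>\<theta>. rng_congruence M \<theta> \<longrightarrow> theta M \<subseteq> \<theta>)"
    using theta_least by blast
  let ?C = "CinfStr U"
  define r where "r M = transport c (cinf_quotient M (theta M))" for M :: "'u cinf"
  define q where "q M = compose (car M) c (quotient_hom M (theta M))" for M :: "'u cinf"
  \<comment> \<open>Closure of \<open>U\<close> under quotients, used for the equivalence relation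
    \<open>theta M\<close>, makes the coding injective and puts the reflection into the
    category.\<close>
  have U: "inj_on c (car (cinf_quotient M (theta M)))" "car (r M) \<in> U"
    if "cinf_structure M" "car M \<in> U" for M
  proof -
    have "equiv (car M) (theta M)"
      using theta_least(1)[OF that(1)] by (simp add: rng_congruence_def cinf_congruence_def)
    then show "inj_on c (car (cinf_quotient M (theta M)))" "car (r M) \<in> U"
      using assms that(2) by (simp_all add: quotient_universe_def cinf_quotient_def r_def transport_def)
  qed
  have M: "cinf_structure M" "inj_on c (car (cinf_quotient M (theta M)))" if "M \<in> obj ?C" for M
    using that U(1) by (simp_all add: CinfStr_def)
  have r: "r M \<in> obj ?C \<and> cinf_ring (r M)" if "M \<in> obj ?C" for M
  proof -
    have "cinf_ring (r M)"
      unfolding r_def by (rule transport_quotient_universal(1)[OF M[OF that]])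
    moreover have "car (r M) \<in> U"
      using that U(2) by (simp add: CinfStr_def)
    ultimately show ?thesis
      by (simp add: CinfStr_def cinf_ring_def)
  qed
  have q: "q M \<in> hom ?C M (r M)" if "M \<in> obj ?C" for M
    using transport_quotient_universal(2)[OF M[OF that]] by (simp add: CinfStr_def r_def q_def)
  have univ: "\<exists>!g. g \<in> hom ?C (r M) N \<and> cmp ?C M (r M) N g (q M) = f"
    if "M \<in> obj ?C" "N \<in> obj ?C" "cinf_ring N" "f \<in> hom ?C M N" for M N f
    using transport_quotient_universal(3)[OF M[OF that(1)] that(3), of f] that(4)
    by (simp add: CinfStr_def r_def q_def)
  have "\<exists>L. adjunction ?C (CinfRng U) L inclusion (\<lambda>M N \<psi>. cmp ?C M (r M) N \<psi> (q M)) \<and> fob L = r"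
    unfolding CinfRng_def
    by (rule adjunction_of_universal_arrows[OF is_category_CinfStr]) (fact r q univ)+
  then obtain L where L: "adjunction ?C (CinfRng U) L inclusion (\<lambda>M N \<psi>. cmp ?C M (r M) N \<psi> (q M))"
    and fob: "fob L = r"
    by (elim exE conjE)
  define \<Phi> where "\<Phi> = (\<lambda>M N \<psi>. cmp ?C M (r M) N \<psi> (q M))"
  have unit: "adj_unit (CinfRng U) L \<Phi> M = q M" if "M \<in> obj ?C" for M
  proof -
    \<comment> \<open>The unit is the bijection at the identity of \<open>r M\<close>, that is, this
      identity composed with \<open>q M\<close>.\<close>
    have "cmp ?C M (r M) (r M) (idn ?C (r M)) (q M) = q M"
      using is_category_CinfStr[of U] that r[OF that] q[OF that] unfolding is_category_def by blast
    then show ?thesis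
      by (simp add: adj_unit_def \<Phi>_def fob CinfRng_def full_subcat_def)
  qed
  have "\<forall>M\<in>obj ?C. fob L M = transport c (cinf_quotient M (theta M)) \<and>
      adj_unit (CinfRng U) L \<Phi> M = compose (car M) c (quotient_hom M (theta M))"
    using unit unfolding fob r_def q_def by blast
  then show "\<exists>L \<Phi>. adjunction (CinfStr U) (CinfRng U) L inclusion \<Phi> \<and>
      (\<forall>M\<in>obj (CinfStr U).
         fob L M = transport c (cinf_quotient M (theta M)) \<and>
         adj_unit (CinfRng U) L \<Phi> M = compose (car M) c (quotient_hom M (theta M)))"
    using L unfolding \<Phi>_def by blast
qed

end
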